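(* Let $n\geq 2$ and $1\leq q\leq n-1$. Let $D$ be a bounded domain in $\mathbb{R}^n$ with smooth boundary. Let $\{D_j\}_{j\geq1}$ be a sequence of open subsets of $D$ with $D_j\subset D_{j+1}$ for all $j$ and $\bigcup_jD_j=D$. If each $D_j$ is $q$-convex, then $D$ is $q$-convex.
   Context: $q$-convexity (in the sense of Harvey–Lawson). Let $\Omega\subset\mathbb{R}^n$ be a bounded open set with smooth boundary, and let $\rho:\mathbb{R}^n\to\mathbb{R}$ be a smooth defining function: $\Omega=\{\rho<0\}$, $\nabla\rho\neq0$ on $\partial\Omega$, normalized so that $|\nabla\rho|=1$ on $\partial\Omega$. The second fundamental form of $\partial\Omega$ at $p\in\partial\Omega$ is the restriction of the quadratic form $\xi\mapsto\sum_{i,j}\frac{\partial^2\rho}{\partial x_i\partial x_j}(p)\xi_i\xi_j$ to $T_p\partial\Omega=\{\xi\in\mathbb{R}^n:\nabla\rho(p)\cdot\xi=0\}$ (sign convention: it is non-negative for convex domains). For $1\leq q\leq n-1$, $\Omega$ is called $q$-convex if at every $p\in\partial\Omega$ the sum of any $q$ eigenvalues (counted with multiplicity) of the second fundamental form on $T_p\partial\Omega$ is non-negative. In particular, saying that an open set is $q$-convex presupposes that it is bounded with smooth boundary. *)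

theory Defs
  imports "HOL-Analysis.Analysis" "HOL-Library.Multiset"
begin

definition partial_derivative :: "'n::finite \<Rightarrow> (real^'n \<Rightarrow> real) \<Rightarrow> real^'n \<Rightarrow> real"
  where "partial_derivative i f x = frechet_derivative f (at x) (axis i 1)"

primrec Ck :: "nat \<Rightarrow> (real^'n::finite \<Rightarrow> real) \<Rightarrow> bool" where
  "Ck 0 f \<longleftrightarrow> continuous_on UNIV f"
| "Ck (Suc k) f \<longleftrightarrow> (\<forall>x. f differentiable (at x)) \<and> (\<forall>i. Ck k (partial_derivative i f))"

definition smooth :: "(real^'n::finite \<Rightarrow> real) \<Rightarrow> bool"
  where "smooth f \<longleftrightarrow> (\<forall>k. Ck k f)"

definition gradient :: "(real^'n::finite \<Rightarrow> real) \<Rightarrow> real^'n \<Rightarrow> real^'n"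
  where "gradient f x = (\<chi> i. partial_derivative i f x)"

definition hessian :: "(real^'n::finite \<Rightarrow> real) \<Rightarrow> real^'n \<Rightarrow> real^'n^'n"
  where "hessian f x = (\<chi> i j. partial_derivative i (partial_derivative j f) x)"

definition defining_function :: "(real^'n::finite \<Rightarrow> real) \<Rightarrow> (real^'n) set \<Rightarrow> bool"
  where "defining_function \<rho> \<Omega> \<longleftrightarrow>
    smooth \<rho> \<and> \<Omega> = {x. \<rho> x < 0} \<and> (\<forall>p\<in>frontier \<Omega>. gradient \<rho> p \<noteq> 0)"

definition normalized_defining_function :: "(real^'n::finite \<Rightarrow> real) \<Rightarrow> (real^'n) set \<Rightarrow> bool"
  where "normalized_defining_function \<rho> \<Omega> \<longleftrightarrow>
    defining_function \<rho> \<Omega> \<and> (\<forall>p\<in>frontier \<Omega>. norm (gradient \<rho> p) = 1)"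

definition has_smooth_boundary :: "(real^'n::finite) set \<Rightarrow> bool"
  where "has_smooth_boundary \<Omega> \<longleftrightarrow> (\<exists>\<rho>. defining_function \<rho> \<Omega>)"

definition tangent_space :: "(real^'n::finite \<Rightarrow> real) \<Rightarrow> real^'n \<Rightarrow> (real^'n) set"
  where "tangent_space \<rho> p = {\<xi>. gradient \<rho> p \<bullet> \<xi> = 0}"

text \<open>The symmetric bilinear form whose diagonal \<open>\<xi> = \<eta>\<close> is the quadratic form
  \<open>\<Sum>i j. (\<partial>\<^sub>i \<partial>\<^sub>j \<rho>)(p) \<xi>\<^sub>i \<xi>\<^sub>j\<close>.  It is to be restricted to the tangent space.\<close>

definition second_fundamental_form ::
    "(real^'n::finite \<Rightarrow> real) \<Rightarrow> real^'n \<Rightarrow> real^'n \<Rightarrow> real^'n \<Rightarrow> real"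
  where "second_fundamental_form \<rho> p \<xi> \<eta> = \<xi> \<bullet> (hessian \<rho> p *v \<eta>)"

text \<open>The eigenspaces of the form on the tangent space, with respect to the Euclidean inner
  product; test vectors \<open>\<eta>\<close> range over the tangent space only, so this is the eigenspace
  of the tangential part of the Hessian.  It is \<open>{0}\<close> unless \<open>\<mu>\<close> is an eigenvalue, and
  its dimension is the multiplicity of \<open>\<mu>\<close>.\<close>

definition sff_eigenspace :: "(real^'n::finite \<Rightarrow> real) \<Rightarrow> real^'n \<Rightarrow> real \<Rightarrow> (real^'n) set"
  where "sff_eigenspace \<rho> p \<mu> =
    {\<xi> \<in> tangent_space \<rho> p. \<forall>\<eta>\<in>tangent_space \<rho> p.
       second_fundamental_form \<rho> p \<xi> \<eta> = \<mu> * (\<xi> \<bullet> \<eta>)}"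

text \<open>A choice of \<open>q\<close> eigenvalues counted with multiplicity is a multiset \<open>M\<close> of size \<open>q\<close>
  containing each \<open>\<mu>\<close> at most as often as its multiplicity.  The choice of \<open>\<rho>\<close> is
  immaterial: two normalized defining functions of \<open>\<Omega>\<close> have the same second
  fundamental form on the tangent spaces of the boundary.\<close>

definition q_convex :: "nat \<Rightarrow> (real^'n::finite) set \<Rightarrow> bool"
  where "q_convex q \<Omega> \<longleftrightarrow>
    bounded \<Omega> \<and> open \<Omega> \<and>
    (\<exists>\<rho>. normalized_defining_function \<rho> \<Omega> \<and>
      (\<forall>p\<in>frontier \<Omega>. \<forall>M::real multiset.
         size M = q \<and> (\<forall>\<mu>. count M \<mu> \<le> dim (sff_eigenspace \<rho> p \<mu>))
         \<longrightarrow> sum_mset M \<ge> 0))"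

end

theory Submission imports Defs "HOL-Computational_Algebra.Polynomial" begin

text \<open>Suppose that the trace of the Hessian of a normalized defining function \<open>\<rho>\<close> over some \<open>q\<close>
  orthonormal tangent vectors is negative at \<open>p \<in> \<partial>D\<close>.  For small \<open>\<epsilon> > 0\<close> the same holds for
  \<open>\<phi> = \<rho> + \<epsilon> \<bar>y - p\<bar>\<^sup>2\<close>, and also for the level sets of \<open>\<phi>\<close> through points near \<open>p\<close>.  The set
  \<open>\<phi> \<le> 0\<close> lies in \<open>D \<union> {p}\<close>, so by compactness some \<open>D\<^sub>j\<close> contains its part on a small sphere
  around \<open>p\<close>; as \<open>p \<notin> D\<^sub>j\<close>, the minimum of \<open>\<phi>\<close> over the closed ball minus \<open>D\<^sub>j\<close> is attained at an
  interior point \<open>x\<close>.  There a sublevel set of \<open>\<phi>\<close> touches \<open>D\<^sub>j\<close> from inside, so the second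
  fundamental form of \<open>\<partial>D\<^sub>j\<close> at \<open>x\<close> is at most that of the level set of \<open>\<phi>\<close>, which contradicts
  the \<open>q\<close>-convexity of \<open>D\<^sub>j\<close>.\<close>

subsection \<open>Smooth functions and normalized defining functions\<close>

lemma Ck_SucD: "Ck (Suc k) f \<Longrightarrow> Ck k f"
proof (induction k arbitrary: f)
  case 0
  then show ?case
    by (auto intro!: continuous_at_imp_continuous_on differentiable_imp_continuous_within)
qed auto

lemma partial_derivative_eqI:
  assumes "(f has_derivative f') (at x)"
  shows "partial_derivative i f x = f' (axis i 1)"
  using frechet_derivative_at[OF assms] by (simp add: partial_derivative_def)

lemma Ck_const: "Ck k (\<lambda>_. c)"
proof (induction k arbitrary: c)
  case (Suc k)
  have "partial_derivative i (\<lambda>_. c) = (\<lambda>_. 0)" for c and i :: 'a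
    by (rule ext) (rule partial_derivative_eqI[OF has_derivative_const])
  then show ?case using Suc by simp
qed simp

lemma Ck_add: "Ck k f \<Longrightarrow> Ck k g \<Longrightarrow> Ck k (\<lambda>x. f x + g x)"
proof (induction k arbitrary: f g)
  case (Suc k)
  have "partial_derivative i (\<lambda>x. f x + g x) =
      (\<lambda>x. partial_derivative i f x + partial_derivative i g x)" for i
  proof
    fix x
    have "f differentiable at x" "g differentiable at x" using Suc.prems by auto
    then have "((\<lambda>x. f x + g x) has_derivative
      (\<lambda>h. frechet_derivative f (at x) h + frechet_derivative g (at x) h)) (at x)"
      by (auto simp: frechet_derivative_works intro!: has_derivative_add)
    from partial_derivative_eqI[OF this, of i] show "partial_derivative i (\<lambda>x. f x + g x) x =
        partial_derivative i f x + partial_derivative i g x"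
      by (simp add: partial_derivative_def)
  qed
  with Suc show ?case by auto
qed (auto intro: continuous_on_add)

lemma Ck_mult: "Ck k f \<Longrightarrow> Ck k g \<Longrightarrow> Ck k (\<lambda>x. f x * g x)"
proof (induction k arbitrary: f g)
  case (Suc k)
  have "partial_derivative i (\<lambda>x. f x * g x) =
      (\<lambda>x. f x * partial_derivative i g x + partial_derivative i f x * g x)" for i
  proof
    fix x
    have "f differentiable at x" "g differentiable at x" using Suc.prems by auto
    then have "((\<lambda>x. f x * g x) has_derivative
      (\<lambda>h. f x * frechet_derivative g (at x) h + frechet_derivative f (at x) h * g x)) (at x)"
      by (auto simp: frechet_derivative_works intro!: has_derivative_mult)
    from partial_derivative_eqI[OF this, of i] show "partial_derivative i (\<lambda>x. f x * g x) x =
        f x * partial_derivative i g x + partial_derivative i f x * g x"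
      by (simp add: partial_derivative_def)
  qed
  moreover have "Ck k f" "Ck k g" using Suc.prems by (blast intro: Ck_SucD)+
  ultimately show ?case
    using Suc by (auto intro!: Ck_add)
qed (auto intro: continuous_on_mult)

text \<open>A partial derivative of \<open>F m (g x)\<close> is one of \<open>g\<close> times
  \<open>F (Suc m) (g x)\<close>, so the induction on \<open>k\<close> treats all members of the
  derivative sequence \<open>F\<close> at once. The set \<open>S\<close> admits outer functions that
  are differentiable on part of the line only, such as real powers on the positive reals.\<close>

lemma Ck_compose:
  assumes F: "\<And>m t. t \<in> S \<Longrightarrow> (F m has_real_derivative F (Suc m) t) (at t)"
    and "\<And>x. g x \<in> S" and "smooth g"
  shows "Ck k (\<lambda>x. F m (g x))"
proof -
  have diff: "g differentiable at x" for x
    using \<open>smooth g\<close> unfolding smooth_def by (metis Ck.simps(2))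
  have deriv: "((\<lambda>x. F m (g x)) has_derivative
      (\<lambda>h. frechet_derivative g (at x) h * F (Suc m) (g x))) (at x)" for x m
  proof -
    have "(F m has_derivative (\<lambda>h. h * F (Suc m) (g x))) (at (g x))"
      using F[OF assms(2), of m x] by (simp add: has_field_derivative_def mult.commute[of _ "F _ _"])
    from has_derivative_compose[OF diff[of x, unfolded frechet_derivative_works] this]
    show ?thesis .
  qed
  have diff': "(\<lambda>x. F m (g x)) differentiable at x" for m x
    using deriv unfolding differentiable_def by blast
  have partial: "partial_derivative i (\<lambda>x. F m (g x)) =
      (\<lambda>x. partial_derivative i g x * F (Suc m) (g x))" for i m
    using partial_derivative_eqI[OF deriv] by (auto simp: partial_derivative_def)
  have "Ck k (partial_derivative i g)" for i k
    using \<open>smooth g\<close> unfolding smooth_def by (metis Ck.simps(2))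
  then show ?thesis
  proof (induction k arbitrary: m)
    case 0
    then show ?case
      using diff' by (auto intro!: continuous_at_imp_continuous_on differentiable_imp_continuous_within)
  next
    case (Suc k)
    then show ?case
      by (auto simp: diff' partial intro!: Ck_mult)
  qed
qed

lemma smooth_compose:
  assumes "\<And>m t. t \<in> S \<Longrightarrow> (F m has_real_derivative F (Suc m) t) (at t)"
    and "\<And>x. g x \<in> S" and "smooth g"
  shows "smooth (\<lambda>x. F m (g x))"
  unfolding smooth_def by (intro allI Ck_compose[where S=S and g=g and F=F] assms)

lemma smooth_const: "smooth (\<lambda>_. c)"
  by (simp add: smooth_def Ck_const)

lemma smooth_add: "smooth f \<Longrightarrow> smooth g \<Longrightarrow> smooth (\<lambda>x. f x + g x)"
  by (simp add: smooth_def Ck_add)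

lemma smooth_mult: "smooth f \<Longrightarrow> smooth g \<Longrightarrow> smooth (\<lambda>x. f x * g x)"
  by (simp add: smooth_def Ck_mult)

lemma smooth_sum: "(\<And>i. i \<in> I \<Longrightarrow> smooth (f i)) \<Longrightarrow> smooth (\<lambda>x. \<Sum>i\<in>I. f i x)"
  by (induction I rule: infinite_finite_induct) (auto simp: smooth_const smooth_add)

lemma smooth_partial: "smooth f \<Longrightarrow> smooth (partial_derivative i f)"
  unfolding smooth_def by (metis Ck.simps(2))

lemma smooth_differentiable: "smooth f \<Longrightarrow> f differentiable at x"
  unfolding smooth_def by (metis Ck.simps(2))

lemma smooth_continuous: "smooth f \<Longrightarrow> continuous_on UNIV f"
  unfolding smooth_def by (metis Ck.simps(1))

lemma defining_function_frontier:
  assumes "defining_function \<rho> D" and "p \<in> frontier D"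
  shows "\<rho> p = 0" and "p \<notin> D"
proof -
  have D: "D = {x. \<rho> x < 0}" and cont: "continuous_on UNIV \<rho>"
    using assms(1) smooth_continuous by (auto simp: defining_function_def)
  have "open D" unfolding D using cont by (intro open_Collect_less) auto
  then show "p \<notin> D" using assms(2) by (auto simp: frontier_def interior_open)
  moreover have "closure D \<subseteq> {x. \<rho> x \<le> 0}"
    using cont by (intro closure_minimal closed_Collect_le) (auto simp: D)
  ultimately show "\<rho> p = 0" using assms(2) by (force simp: frontier_def D)
qed

text \<open>The polynomial parameter closes the family under differentiation: for t > 0 the
  derivative of p(1/t) exp(-1/t) is (1/t)^2 (p - p')(1/t) exp(-1/t). The member
  \<open>flat 1\<close> is the classical smooth function that vanishes on the half-line t \<le> 0
  and is positive for t > 0.\<close>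

definition flat :: "real poly \<Rightarrow> real \<Rightarrow> real"
  where "flat p t = (if t > 0 then poly p (1 / t) * exp (- 1 / t) else 0)"

lemma poly_mult_exp_tendsto_0: "((\<lambda>x::real. poly p x * exp (- x)) \<longlongrightarrow> 0) at_top"
proof -
  have "((\<lambda>x::real. \<Sum>i\<le>degree p. coeff p i * (x ^ i / exp x)) \<longlongrightarrow> (\<Sum>i\<le>degree p. coeff p i * 0)) at_top"
    by (intro tendsto_intros tendsto_power_div_exp_0)
  then show ?thesis
    by (simp add: poly_altdef sum_distrib_right exp_minus divide_inverse mult.assoc)
qed

lemma flat_has_derivative:
  "(flat p has_real_derivative flat ([:0, 0, 1:] * (p - pderiv p)) t) (at t)"
proof -
  consider "t > 0" | "t < 0" | "t = 0" by linarith
  then show ?thesis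
  proof cases
    case 1
    have "((\<lambda>t. poly p (1 / t) * exp (- 1 / t)) has_real_derivative
        flat ([:0, 0, 1:] * (p - pderiv p)) t) (at t)"
      using 1 by (auto intro!: derivative_eq_intros poly_DERIV DERIV_chain2[where f="poly p"]
          simp: flat_def field_simps power2_eq_square)
    then show ?thesis
      by (rule DERIV_cong_ev[THEN iffD1, rotated -1])
        (use 1 in \<open>auto simp: flat_def eventually_nhds intro!: exI[of _ "{0<..}"]\<close>)
  next
    case 2
    have "((\<lambda>t. 0) has_real_derivative flat ([:0, 0, 1:] * (p - pderiv p)) t) (at t)"
      using 2 by (auto simp: flat_def)
    then show ?thesis
      by (rule DERIV_cong_ev[THEN iffD1, rotated -1])
        (use 2 in \<open>auto simp: flat_def eventually_nhds intro!: exI[of _ "{..<0}"]\<close>)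
  next
    case 3
    \<comment> \<open>With x = 1/h the difference quotient from the right at 0 becomes x p(x)
      exp(-x), and \<open>pCons 0 p\<close> is the polynomial x p(x).\<close>
    have "((\<lambda>h. flat p h / h) \<longlongrightarrow> 0) (at_right 0)"
    proof -
      have "((\<lambda>h. poly (pCons 0 p) (inverse h) * exp (- inverse h)) \<longlongrightarrow> 0) (at_right 0)"
        by (rule filterlim_compose[OF poly_mult_exp_tendsto_0 filterlim_inverse_at_top_right])
      then show ?thesis
        by (rule Lim_transform_eventually)
          (auto simp: eventually_at_right_field flat_def field_simps intro!: exI[of _ 1])
    qed
    moreover have "((\<lambda>h. flat p h / h) \<longlongrightarrow> 0) (at_left 0)"
      by (rule Lim_transform_eventually[OF tendsto_const])
        (auto simp: eventually_at_left_field flat_def intro!: exI[of _ "-1"])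
    ultimately show ?thesis
      using 3 by (auto simp: DERIV_def flat_def intro: filterlim_split_at)
  qed
qed

lemma smooth_flat_compose:
  assumes "smooth g" shows "smooth (\<lambda>x. flat 1 (g x))"
  using smooth_compose[where S=UNIV and m=0 and g=g
      and F="\<lambda>m. flat (((\<lambda>p. [:0, 0, 1:] * (p - pderiv p)) ^^ m) 1)"] 
    assms flat_has_derivative by simp

lemma smooth_powr_compose:
  assumes "smooth g" "\<And>x. g x > 0" shows "smooth (\<lambda>x. g x powr a)"
proof -
  define F where "F m t = (\<Prod>i<m. a - real i) * t powr (a - real m)" for m and t :: real
  have "(F m has_real_derivative F (Suc m) t) (at t)" if "t \<in> {0<..}" for m t
    unfolding F_def using that
    by (auto intro!: derivative_eq_intros simp: algebra_simps)
  from smooth_compose[where S="{0<..}" and F=F and g=g and m=0, OF this] show ?thesis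
    using assms by (simp add: F_def)
qed

section \<open>Normalizing a defining function\<close>

lemma smooth_has_derivative:
  fixes f :: "real^'n::finite \<Rightarrow> real"
  assumes "smooth f"
  shows "(f has_derivative (\<lambda>h. gradient f x \<bullet> h)) (at x)"
proof -
  let ?f' = "frechet_derivative f (at x)"
  have f': "(f has_derivative ?f') (at x)"
    using smooth_differentiable[OF assms] frechet_derivative_works by blast
  interpret linear ?f' using f' by (rule has_derivative_linear)
  have "?f' = (\<lambda>h. gradient f x \<bullet> h)"
  proof
    fix h
    have "?f' h = ?f' (\<Sum>i\<in>UNIV. h $ i *\<^sub>R axis i 1)"
      using basis_expansion[of h] by (simp add: scalar_mult_eq_scaleR)
    also have "\<dots> = gradient f x \<bullet> h"
      by (simp add: sum scale inner_vec_def gradient_def partial_derivative_def mult.commute)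
    finally show "?f' h = gradient f x \<bullet> h" .
  qed
  then show ?thesis using f' by simp
qed

text \<open>As \<open>\<nabla>\<rho>\<close> may vanish away from the boundary, \<open>\<rho>\<close> is divided not by \<open>\<bar>\<nabla>\<rho>\<bar>\<close> but by the root of a
  positive smooth function that agrees with \<open>\<bar>\<nabla>\<rho>\<bar>\<^sup>2\<close> wherever that is at least \<open>c > 0\<close>.\<close>

lemma normalized_defining_function_exists:
  fixes D :: "(real^'n::finite) set"
  assumes "bounded D" and "has_smooth_boundary D"
  shows "\<exists>\<rho>. normalized_defining_function \<rho> D"
proof -
  obtain \<rho> where \<rho>: "smooth \<rho>" "D = {x. \<rho> x < 0}" "\<And>p. p \<in> frontier D \<Longrightarrow> gradient \<rho> p \<noteq> 0"
    using assms(2) unfolding has_smooth_boundary_def defining_function_def by auto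
  define g where "g x = (\<Sum>i\<in>UNIV. partial_derivative i \<rho> x * partial_derivative i \<rho> x)" for x
  have g_eq: "g x = (norm (gradient \<rho> x))\<^sup>2" for x
    by (simp add: g_def power2_norm_eq_inner inner_vec_def gradient_def)
  have smg: "smooth g"
    unfolding g_def by (intro smooth_sum smooth_mult smooth_partial \<rho>)
  obtain c where c: "c > 0" "\<And>p. p \<in> frontier D \<Longrightarrow> g p \<ge> c"
  proof (cases "frontier D = {}")
    case False
    have "\<exists>y\<in>frontier D. \<forall>x\<in>frontier D. g y \<le> g x"
      using assms(1) False smooth_continuous[OF smg]
      by (intro continuous_attains_inf) (auto intro: continuous_on_subset)
    then obtain y where y: "y \<in> frontier D" "\<And>x. x \<in> frontier D \<Longrightarrow> g y \<le> g x" by blast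
    have "g y > 0" using \<rho>(3)[OF y(1)] by (simp add: g_eq)
    with y show ?thesis using that by blast
  qed (use that[of 1] in auto)
  \<comment> \<open>Where \<open>g x \<ge> c\<close>, in particular on the frontier, the flat term
    vanishes and \<open>G x = g x\<close>. Where \<open>g x = 0\<close> the flat term is
    \<open>flat 1 c > 0\<close>, so \<open>G\<close> has no zeros.\<close>
  define G where "G x = g x + flat 1 (c + (- 1) * g x)" for x
  have smG: "smooth G"
    unfolding G_def by (intro smooth_add smooth_flat_compose smooth_mult smooth_const smg)
  have Gpos: "G x > 0" for x
  proof (cases "g x = 0")
    case True
    then show ?thesis using c by (simp add: G_def flat_def)
  next
    case False
    have "flat 1 s \<ge> 0" for s by (simp add: flat_def)
    moreover have "g x > 0" using False by (simp add: g_eq)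
    ultimately show ?thesis unfolding G_def by (metis add_pos_nonneg)
  qed
  define h where "h x = G x powr (- 1 / 2)" for x
  have smh: "smooth h" unfolding h_def by (intro smooth_powr_compose smG Gpos)
  have hpos: "h x > 0" for x using Gpos[of x] by (simp add: h_def)
  let ?r = "\<lambda>x. h x * \<rho> x"
  have smr: "smooth ?r" by (intro smooth_mult smh \<rho>)
  have "D = {x. ?r x < 0}" using hpos \<rho>(2) by (auto simp: mult_less_0_iff dest: less_asym)
  moreover have "norm (gradient ?r p) = 1" if p: "p \<in> frontier D" for p
  proof -
    have "\<rho> p = 0"
      using defining_function_frontier(1)[OF _ p, of \<rho>] \<rho> by (simp add: defining_function_def)
    \<comment> \<open>As \<open>\<rho>\<close> vanishes at \<open>p\<close>, the product rule loses
      its term with the gradient of \<open>h\<close>, and the gradient of \<open>\<rho>\<close> is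
      merely scaled by \<open>h p\<close>.\<close>
    have "(?r has_derivative (\<lambda>k. h p * (gradient \<rho> p \<bullet> k) + (gradient h p \<bullet> k) * \<rho> p)) (at p)"
      by (intro has_derivative_mult smooth_has_derivative smh \<rho>)
    then have "(?r has_derivative (\<lambda>k. (h p *\<^sub>R gradient \<rho> p) \<bullet> k)) (at p)"
      by (simp add: \<open>\<rho> p = 0\<close>)
    then have "gradient ?r p = h p *\<^sub>R gradient \<rho> p"
      by (simp add: gradient_def[of ?r] partial_derivative_eqI vec_eq_iff inner_axis)
    moreover have "h p = 1 / norm (gradient \<rho> p)"
    proof -
      have "G p = (norm (gradient \<rho> p))\<^sup>2"
        using c(2)[OF p] by (simp add: G_def flat_def g_eq)
      then show ?thesis
        using \<rho>(3)[OF p] by (simp add: h_def powr_minus powr_half_sqrt inverse_eq_divide)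
    qed
    ultimately show ?thesis using \<rho>(3)[OF p] by simp
  qed
  ultimately have "normalized_defining_function ?r D"
    unfolding normalized_defining_function_def defining_function_def using smr by fastforce
  then show ?thesis by blast
qed

subsection \<open>Symmetric forms on a subspace\<close>

text \<open>A minimizer \<open>f\<close> of \<open>B v v\<close> on the unit sphere of
  \<open>T\<close> will do: the form \<open>Q\<close> is nonnegative on \<open>T\<close> and
  vanishes at \<open>f\<close>, so its first variation at \<open>f\<close> vanishes in every
  direction of \<open>T\<close>.\<close>

lemma minimal_eigenvector:
  fixes B :: "'a::euclidean_space \<Rightarrow> 'a \<Rightarrow> real"
  assumes "subspace T" and "T \<noteq> {0}" and B: "bounded_bilinear B" and sym: "\<And>x y. B x y = B y x"
  obtains f where "f \<in> T" "norm f = 1" "\<And>\<eta>. \<eta> \<in> T \<Longrightarrow> B f \<eta> = B f f * (f \<bullet> \<eta>)"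
proof -
  interpret B: bounded_bilinear B by fact
  have "compact (T \<inter> sphere 0 1)"
    using closed_subspace[OF \<open>subspace T\<close>] by (simp add: closed_Int_compact)
  moreover obtain v where "v \<in> T" "v \<noteq> 0"
    using assms(1,2) subspace_0 by blast
  then have "v /\<^sub>R norm v \<in> T \<inter> sphere 0 1"
    using \<open>subspace T\<close> by (simp add: subspace_scale)
  then have "T \<inter> sphere 0 1 \<noteq> {}" by blast
  moreover have "continuous_on (T \<inter> sphere 0 1) (\<lambda>v. B v v)"
    by (intro B.continuous_on continuous_on_id)
  ultimately obtain f where f: "f \<in> T" "norm f = 1"
    and min: "\<And>v. v \<in> T \<Longrightarrow> norm v = 1 \<Longrightarrow> B f f \<le> B v v"
    using continuous_attains_inf[of "T \<inter> sphere 0 1" "\<lambda>v. B v v"]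
    by (metis IntD1 IntD2 IntI mem_sphere_0)
  have ff: "f \<bullet> f = 1" using f(2) by (simp add: norm_eq_1)
  define Q where "Q v = B v v - B f f * (v \<bullet> v)" for v
  have Q: "Q v \<ge> 0" if "v \<in> T" for v
  proof (cases "v = 0")
    case False
    have "B f f \<le> B (v /\<^sub>R norm v) (v /\<^sub>R norm v)"
      using that False \<open>subspace T\<close> by (intro min) (auto simp: subspace_scale)
    then show ?thesis
      using False by (simp add: Q_def B.scaleR_left B.scaleR_right field_simps
          flip: power2_norm_eq_inner power2_eq_square)
  qed (simp add: Q_def B.zero_left)
  have "B f \<eta> = B f f * (f \<bullet> \<eta>)" if "\<eta> \<in> T" for \<eta>
  proof (rule ccontr)
    define b where "b = B f \<eta> - B f f * (f \<bullet> \<eta>)"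
    define c where "c = Q \<eta>"
    assume "B f \<eta> \<noteq> B f f * (f \<bullet> \<eta>)"
    then have "b \<noteq> 0" by (simp add: b_def)
    have "c \<ge> 0" using Q that by (simp add: c_def)
    have quad: "2 * t * b + t\<^sup>2 * c \<ge> 0" for t
    proof -
      have "Q (f + t *\<^sub>R \<eta>) = 2 * t * b + t\<^sup>2 * c"
        by (simp add: Q_def b_def c_def B.add_left B.add_right B.scaleR_left B.scaleR_right
            sym[of \<eta> f] inner_commute[of \<eta> f] inner_add_left inner_add_right ff algebra_simps power2_eq_square)
      moreover have "f + t *\<^sub>R \<eta> \<in> T"
        using f(1) that \<open>subspace T\<close> by (intro subspace_add subspace_scale)
      ultimately show ?thesis using Q by metis
    qed
    \<comment> \<open>With \<open>b \<noteq> 0\<close> the linear term dominates for small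
      \<open>t\<close> of sign opposite to \<open>b\<close>, which makes the quadratic negative. The
      summand 1 in the witness \<open>- b / (c + 1)\<close> covers the case
      \<open>c = 0\<close>.\<close>
    have "2 * (- b / (c + 1)) * b + (- b / (c + 1))\<^sup>2 * c = - (b\<^sup>2 * (c + 2)) / (c + 1)\<^sup>2"
      using \<open>c \<ge> 0\<close> by (simp add: divide_simps) (simp add: algebra_simps power2_eq_square)
    also have "\<dots> < 0" using \<open>c \<ge> 0\<close> \<open>b \<noteq> 0\<close> by simp
    finally show False using quad[of "- b / (c + 1)"] by simp
  qed
  with f show ?thesis using that by blast
qed

text \<open>Spectral theorem for a form restricted to \<open>T\<close>, by induction on the
  dimension: split off a minimal eigenvector \<open>f\<close> and continue in its orthogonal
  complement within \<open>T\<close>.\<close>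

lemma spectral_basis:
  fixes B :: "'a::euclidean_space \<Rightarrow> 'a \<Rightarrow> real"
  assumes "subspace T" and B: "bounded_bilinear B" and sym: "\<And>x y. B x y = B y x"
  shows "\<exists>F. finite F \<and> F \<subseteq> T \<and> pairwise orthogonal F \<and> (\<forall>f\<in>F. norm f = 1) \<and> span F = T \<and>
     (\<forall>f\<in>F. \<forall>\<eta>\<in>T. B f \<eta> = B f f * (f \<bullet> \<eta>))"
  using \<open>subspace T\<close>
proof (induction "dim T" arbitrary: T rule: less_induct)
  case less
  interpret B: bounded_bilinear B by fact
  show ?case
  proof (cases "T = {0}")
    case True
    then show ?thesis by (intro exI[of _ "{}"]) auto
  next
    case False
    obtain f where f: "f \<in> T" "norm f = 1" "\<And>\<eta>. \<eta> \<in> T \<Longrightarrow> B f \<eta> = B f f * (f \<bullet> \<eta>)"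
      using minimal_eigenvector[OF less.prems False B sym] by blast
    have ff: "f \<bullet> f = 1" using f(2) by (simp add: norm_eq_1)
    define T' where "T' = {v \<in> T. f \<bullet> v = 0}"
    have subT': "subspace T'"
      using less.prems by (auto simp: T'_def subspace_def inner_simps)
    have "f \<notin> T'" using ff by (simp add: T'_def)
    then have "T' \<subset> T" using f(1) unfolding T'_def by blast
    then have "dim T' < dim T"
      using subT' less.prems by (metis dim_psubset span_eq_iff)
    from less.hyps[OF this subT'] obtain F where F: "finite F" "F \<subseteq> T'" "pairwise orthogonal F"
      "\<And>g. g \<in> F \<Longrightarrow> norm g = 1" "span F = T'"
      "\<And>g \<eta>. g \<in> F \<Longrightarrow> \<eta> \<in> T' \<Longrightarrow> B g \<eta> = B g g * (g \<bullet> \<eta>)" by blast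
    have decomp: "v - (f \<bullet> v) *\<^sub>R f \<in> T'" if "v \<in> T" for v
      using that f(1) less.prems ff by (auto simp: T'_def subspace_diff subspace_scale inner_simps)
    have "span (insert f F) = T"
    proof
      show "span (insert f F) \<subseteq> T"
        using f(1) F(2) \<open>T' \<subset> T\<close> less.prems by (intro span_minimal) auto
      show "T \<subseteq> span (insert f F)"
        using decomp F(5) by (auto simp: span_insert)
    qed
    moreover have "pairwise orthogonal (insert f F)"
      using F(2,3) by (auto simp: pairwise_insert orthogonal_def T'_def inner_commute)
    \<comment> \<open>The induction hypothesis tests only against vectors of \<open>T'\<close>. The
      missing test vector \<open>f\<close> is harmless, since by symmetry
      \<open>B g f = B f g = B f f * (f \<bullet> g) = 0\<close>.\<close>
    moreover have "B g \<eta> = B g g * (g \<bullet> \<eta>)" if "g \<in> F" "\<eta> \<in> T" for g \<eta>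
    proof -
      have g: "g \<in> T" "f \<bullet> g = 0" using that(1) F(2) by (auto simp: T'_def)
      have "B g (\<eta> - (f \<bullet> \<eta>) *\<^sub>R f) = B g g * (g \<bullet> (\<eta> - (f \<bullet> \<eta>) *\<^sub>R f))"
        using F(6)[OF that(1) decomp[OF that(2)]] .
      then show ?thesis
        using f(3)[OF g(1)] g(2)
        by (simp add: B.diff_right B.scaleR_right sym[of g f] inner_simps inner_commute[of g f])
    qed
    moreover have "insert f F \<subseteq> T" using f(1) F(2) \<open>T' \<subset> T\<close> by blast
    moreover have "\<forall>g\<in>insert f F. norm g = 1" using f(2) F(4) by simp
    ultimately have "finite (insert f F) \<and> insert f F \<subseteq> T \<and> pairwise orthogonal (insert f F) \<and>
        (\<forall>g\<in>insert f F. norm g = 1) \<and> span (insert f F) = T \<and>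
        (\<forall>g\<in>insert f F. \<forall>\<eta>\<in>T. B g \<eta> = B g g * (g \<bullet> \<eta>))"
      using f(3) F(1) by (metis finite_insert insert_iff)
    then show ?thesis ..
  qed
qed

text \<open>Greedy choice: each step adds a minimizer of the remaining elements. This selects the
  \<open>q\<close> smallest eigenvalues below.\<close>

lemma smallest_subset_exists:
  fixes \<mu> :: "'a \<Rightarrow> real"
  assumes "finite F" and "q \<le> card F"
  shows "\<exists>S\<subseteq>F. card S = q \<and> (\<forall>s\<in>S. \<forall>t\<in>F - S. \<mu> s \<le> \<mu> t)"
  using assms(2)
proof (induction q)
  case 0
  then show ?case by (intro exI[of _ "{}"]) auto
next
  case (Suc q)
  then obtain S where S: "S \<subseteq> F" "card S = q" "\<forall>s\<in>S. \<forall>t\<in>F - S. \<mu> s \<le> \<mu> t" by auto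
  have "F - S \<noteq> {}" using S(1,2) Suc.prems by auto
  then obtain s where s: "s \<in> F - S" "\<forall>t\<in>F - S. \<mu> s \<le> \<mu> t"
    using ex_min_if_finite[of "\<mu> ` (F - S)"] \<open>finite F\<close> by (force simp: not_less)
  then show ?case
    using S finite_subset[OF S(1) \<open>finite F\<close>] by (intro exI[of _ "insert s S"]) auto
qed

section \<open>Traces over orthonormal families and sums of eigenvalues\<close>

lemma bessel_inequality:
  fixes e :: "'i \<Rightarrow> 'a::real_inner"
  assumes "finite I" and e: "\<And>i j. i \<in> I \<Longrightarrow> j \<in> I \<Longrightarrow> e i \<bullet> e j = (if i = j then 1 else 0)"
  shows "(\<Sum>i\<in>I. (e i \<bullet> f)\<^sup>2) \<le> f \<bullet> f"
proof -
  let ?p = "\<Sum>i\<in>I. (e i \<bullet> f) *\<^sub>R e i"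
  have fp: "f \<bullet> ?p = (\<Sum>i\<in>I. (e i \<bullet> f)\<^sup>2)"
    by (simp add: inner_sum_right inner_commute[of f] power2_eq_square)
  have "?p \<bullet> ?p = (\<Sum>i\<in>I. \<Sum>j\<in>I. (e i \<bullet> f) * (e j \<bullet> f) * (e i \<bullet> e j))"
    by (simp add: inner_sum_right inner_sum_left sum_distrib_left mult_ac inner_commute)
  also have "\<dots> = (\<Sum>i\<in>I. \<Sum>j\<in>I. if i = j then (e i \<bullet> f)\<^sup>2 else 0)"
    by (intro sum.cong) (auto simp: e power2_eq_square)
  also have "\<dots> = (\<Sum>i\<in>I. (e i \<bullet> f)\<^sup>2)" using \<open>finite I\<close> by simp
  finally have pp: "?p \<bullet> ?p = (\<Sum>i\<in>I. (e i \<bullet> f)\<^sup>2)" .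
  have "0 \<le> (f - ?p) \<bullet> (f - ?p)" by simp
  also have "\<dots> = f \<bullet> f - (\<Sum>i\<in>I. (e i \<bullet> f)\<^sup>2)"
    by (simp only: inner_diff_left inner_diff_right inner_commute[of ?p f] fp pp)
  finally show ?thesis by simp
qed

text \<open>Ky Fan's principle: the trace over an orthonormal family is a combination of the eigenvalues
  with weights in \<open>[0, 1]\<close> of total mass \<open>q\<close>.\<close>

lemma trace_nonneg_if_eigenvalue_sums_nonneg:
  fixes B :: "'a::euclidean_space \<Rightarrow> 'a \<Rightarrow> real"
  assumes "subspace T" and B: "bounded_bilinear B" and sym: "\<And>x y. B x y = B y x"
    and M: "\<And>M. size M = q \<Longrightarrow>
      (\<And>\<mu>. count M \<mu> \<le> dim {\<xi> \<in> T. \<forall>\<eta>\<in>T. B \<xi> \<eta> = \<mu> * (\<xi> \<bullet> \<eta>)}) \<Longrightarrow> sum_mset M \<ge> 0"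
    and "finite I" "card I = q" and eT: "\<And>i. i \<in> I \<Longrightarrow> e i \<in> T"
    and e: "\<And>i j. i \<in> I \<Longrightarrow> j \<in> I \<Longrightarrow> e i \<bullet> e j = (if i = j then 1 else 0)"
  shows "(\<Sum>i\<in>I. B (e i) (e i)) \<ge> 0"
proof -
  interpret B: bounded_bilinear B by fact
  obtain F where F: "finite F" "F \<subseteq> T" "pairwise orthogonal F" "\<And>f. f \<in> F \<Longrightarrow> norm f = 1"
    "span F = T" "\<And>f \<eta>. f \<in> F \<Longrightarrow> \<eta> \<in> T \<Longrightarrow> B f \<eta> = B f f * (f \<bullet> \<eta>)"
    using spectral_basis[OF assms(1-2) sym] by blast
  \<comment> \<open>These are the weights of the eigenvalues in the trace: \<open>c f\<close> is the
    squared length of the projection of \<open>f\<close> to the span of the family \<open>e\<close>.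
    Bessel's inequality bounds it by 1, and expanding each \<open>e i\<close> in the basis
    \<open>F\<close> gives total mass \<open>q\<close>.\<close>
  define c where "c f = (\<Sum>i\<in>I. (e i \<bullet> f)\<^sup>2)" for f
  have expand: "(\<Sum>f\<in>F. (e i \<bullet> f) *\<^sub>R f) = e i" if "i \<in> I" for i
    using F eT[OF that] by (intro orthonormal_basis_expand) auto
  have c01: "0 \<le> c f" "f \<in> F \<Longrightarrow> c f \<le> 1" for f
    using bessel_inequality[of I e f, OF \<open>finite I\<close> e] F(4)[of f]
    by (auto simp: c_def sum_nonneg norm_eq_1)
  have csum: "(\<Sum>f\<in>F. c f) = q"
  proof -
    have "(\<Sum>f\<in>F. c f) = (\<Sum>i\<in>I. \<Sum>f\<in>F. (e i \<bullet> f)\<^sup>2)"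
      unfolding c_def by (rule sum.swap)
    also have "\<dots> = (\<Sum>i\<in>I. e i \<bullet> (\<Sum>f\<in>F. (e i \<bullet> f) *\<^sub>R f))"
      by (simp add: inner_sum_right power2_eq_square)
    also have "\<dots> = (\<Sum>i\<in>I. 1)" using expand e by (intro sum.cong) auto
    finally show ?thesis using \<open>card I = q\<close> by simp
  qed
  have trace: "(\<Sum>i\<in>I. B (e i) (e i)) = (\<Sum>f\<in>F. B f f * c f)"
  proof -
    have "B (e i) (e i) = (\<Sum>f\<in>F. B f f * (e i \<bullet> f)\<^sup>2)" if "i \<in> I" for i
    proof -
      have "B (e i) (e i) = B (\<Sum>f\<in>F. (e i \<bullet> f) *\<^sub>R f) (e i)" using expand that by simp
      also have "\<dots> = (\<Sum>f\<in>F. (e i \<bullet> f) * B f (e i))" by (simp add: B.sum_left B.scaleR_left)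
      also have "\<dots> = (\<Sum>f\<in>F. B f f * (e i \<bullet> f)\<^sup>2)"
        using F(6)[OF _ eT[OF that]]
        by (intro sum.cong) (auto simp: power2_eq_square inner_commute)
      finally show ?thesis .
    qed
    then have "(\<Sum>i\<in>I. B (e i) (e i)) = (\<Sum>i\<in>I. \<Sum>f\<in>F. B f f * (e i \<bullet> f)\<^sup>2)" by simp
    also have "\<dots> = (\<Sum>f\<in>F. B f f * c f)"
      unfolding c_def sum_distrib_left by (rule sum.swap)
    finally show ?thesis .
  qed
  have "real q \<le> card F"
    using sum_mono[of F c "\<lambda>_. 1"] c01 csum by simp
  then obtain S where S: "S \<subseteq> F" "card S = q" "\<And>s t. s \<in> S \<Longrightarrow> t \<in> F - S \<Longrightarrow> B s s \<le> B t t"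
    using smallest_subset_exists[OF F(1), of q "\<lambda>f. B f f"] by auto
  have "finite S" using S(1) F(1) by (rule finite_subset)
  \<comment> \<open>The threshold \<open>m\<close> separates the \<open>q\<close> smallest
    eigenvalues from the others; if \<open>S\<close> is empty, any value serves.\<close>
  obtain m where m: "\<And>s. s \<in> S \<Longrightarrow> B s s \<le> m" "\<And>t. t \<in> F - S \<Longrightarrow> S \<noteq> {} \<Longrightarrow> m \<le> B t t"
  proof (cases "S = {}")
    case False
    then have "Max ((\<lambda>f. B f f) ` S) \<in> (\<lambda>f. B f f) ` S" using \<open>finite S\<close> by simp
    with that[of "Max ((\<lambda>f. B f f) ` S)"] S(3) \<open>finite S\<close> show ?thesis by auto
  qed auto
  have "(\<Sum>f\<in>S. B f f) \<le> (\<Sum>f\<in>F. B f f * c f)"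
  proof (cases "S = {}")
    case True
    then have "(\<Sum>f\<in>F. c f) = 0" using csum S(2) by simp
    then have "\<forall>f\<in>F. c f = 0" using c01 F(1) by (simp add: sum_nonneg_eq_0_iff)
    then show ?thesis using True by simp
  next
    case False
    \<comment> \<open>Moving the weights from the indicator of \<open>S\<close> to \<open>c\<close>
      can only raise the weighted sum: on \<open>S\<close> both factors are at most 0, outside
      \<open>S\<close> both are at least 0. The threshold cancels in the end because both weightings
      have mass \<open>q\<close>.\<close>
    have "0 \<le> (\<Sum>f\<in>F. (B f f - m) * (c f - (if f \<in> S then 1 else 0)))"
    proof (rule sum_nonneg)
      fix f assume "f \<in> F"
      then show "0 \<le> (B f f - m) * (c f - (if f \<in> S then 1 else 0))"
        using m[of f] c01[of f] False by (auto intro: mult_nonneg_nonneg mult_nonpos_nonpos)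
    qed
    also have "\<dots> = (\<Sum>f\<in>F. B f f * c f) - m * (\<Sum>f\<in>F. c f)
        - (\<Sum>f\<in>F. if f \<in> S then B f f - m else 0)"
      by (simp add: sum_distrib_left flip: sum_subtractf) (intro sum.cong, auto simp: algebra_simps)
    also have "(\<Sum>f\<in>F. if f \<in> S then B f f - m else 0) = (\<Sum>f\<in>S. B f f) - m * q"
      using S(1,2) F(1) by (simp add: sum.inter_restrict[symmetric] Int_absorb1 sum_subtractf)
    finally show ?thesis using csum by simp
  qed
  moreover have "(\<Sum>f\<in>S. B f f) \<ge> 0"
  proof -
    \<comment> \<open>The selected eigenvalues form an admissible multiset: the vectors of
      \<open>S\<close> with eigenvalue \<open>\<mu>\<close> are orthonormal, hence independent, in
      the eigenspace of \<open>\<mu>\<close>.\<close>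
    let ?M = "image_mset (\<lambda>f. B f f) (mset_set S)"
    have "count ?M \<mu> \<le> dim {\<xi> \<in> T. \<forall>\<eta>\<in>T. B \<xi> \<eta> = \<mu> * (\<xi> \<bullet> \<eta>)}" for \<mu>
    proof -
      let ?S = "(\<lambda>f. B f f) -` {\<mu>} \<inter> S"
      have "count ?M \<mu> = (\<Sum>f\<in>?S. 1)"
        unfolding count_image_mset using \<open>finite S\<close> by (intro sum.cong) auto
      also have "\<dots> = card ?S" by simp
      also have "\<dots> \<le> dim {\<xi> \<in> T. \<forall>\<eta>\<in>T. B \<xi> \<eta> = \<mu> * (\<xi> \<bullet> \<eta>)}"
      proof (rule independent_card_le_dim)
        show "independent ?S"
          using pairwise_orthogonal_independent[of ?S] S(1) F(3,4)
          by (metis IntE norm_zero pairwise_subset subset_iff zero_neq_one)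
      qed (use S(1) F(2,6) in auto)
      finally show ?thesis .
    qed
    from M[OF _ this] S(2) show ?thesis by (simp add: sum_unfold_sum_mset)
  qed
  ultimately show ?thesis using trace by simp
qed

lemma sum_mset_eq_sum_count:
  fixes M :: "'a::comm_semiring_1 multiset"
  assumes "finite A" "set_mset M \<subseteq> A"
  shows "(\<Sum>x\<in>A. of_nat (count M x) * x) = sum_mset M"
  using assms(2)
proof (induction M)
  case (add y M)
  have "(\<Sum>x\<in>A. of_nat (count (add_mset y M) x) * x) =
      (\<Sum>x\<in>A. (if x = y then y else 0) + of_nat (count M x) * x)"
    by (intro sum.cong) (auto simp: algebra_simps)
  also have "\<dots> = sum_mset (add_mset y M)"
    using add \<open>finite A\<close> by (simp add: sum.distrib)
  finally show ?case .
qed simp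

text \<open>The passage from eigenvalue sums back to traces: take \<open>count M \<mu>\<close>
  orthonormal vectors in each eigenspace. Eigenspaces of distinct eigenvalues are orthogonal by
  symmetry of \<open>B\<close>, so the union is orthonormal.\<close>

lemma orthonormal_eigenvectors_exist:
  fixes B :: "'a::euclidean_space \<Rightarrow> 'a \<Rightarrow> real"
  assumes "subspace T" and B: "bounded_bilinear B" and sym: "\<And>x y. B x y = B y x"
    and M: "\<And>\<mu>. count M \<mu> \<le> dim {\<xi> \<in> T. \<forall>\<eta>\<in>T. B \<xi> \<eta> = \<mu> * (\<xi> \<bullet> \<eta>)}"
  obtains E where "finite E" "card E = size M" "E \<subseteq> T"
    "\<forall>x\<in>E. \<forall>y\<in>E. x \<bullet> y = (if x = y then 1 else 0)"
    "(\<Sum>x\<in>E. B x x) = sum_mset M"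
proof -
  interpret B: bounded_bilinear B by fact
  define V where "V \<mu> = {\<xi> \<in> T. \<forall>\<eta>\<in>T. B \<xi> \<eta> = \<mu> * (\<xi> \<bullet> \<eta>)}" for \<mu>
  have subV: "subspace (V \<mu>)" for \<mu>
    using \<open>subspace T\<close>
    by (auto simp: V_def subspace_def B.zero_left B.add_left B.scaleR_left inner_add_left algebra_simps)
  have "\<exists>E\<subseteq>V \<mu>. finite E \<and> card E = count M \<mu> \<and> pairwise orthogonal E \<and> (\<forall>x\<in>E. norm x = 1)" for \<mu>
  proof -
    obtain C where C: "C \<subseteq> V \<mu>" "pairwise orthogonal C" "\<And>x. x \<in> C \<Longrightarrow> norm x = 1"
      "independent C" "card C = dim (V \<mu>)"
      using orthonormal_basis_subspace[OF subV] by metis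
    then obtain E where "E \<subseteq> C" "card E = count M \<mu>"
      using M[of \<mu>] obtain_subset_with_card_n[of "count M \<mu>" C] unfolding V_def by metis
    moreover from this have "finite E" "pairwise orthogonal E"
      using finite_subset[OF _ independent_imp_finite[OF C(4)]] pairwise_subset[OF C(2)] by auto
    ultimately show ?thesis
      using C(1,3) by (intro exI[of _ E]) auto
  qed
  then obtain E where E: "\<And>\<mu>. E \<mu> \<subseteq> V \<mu>" "\<And>\<mu>. finite (E \<mu>)" "\<And>\<mu>. card (E \<mu>) = count M \<mu>"
    "\<And>\<mu>. pairwise orthogonal (E \<mu>)" "\<And>\<mu> x. x \<in> E \<mu> \<Longrightarrow> norm x = 1" by metis
  have orth: "x \<bullet> y = 0" if "x \<in> V \<mu>" "y \<in> V \<nu>" "\<mu> \<noteq> \<nu>" for x y \<mu> \<nu>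
  proof -
    have "\<mu> * (x \<bullet> y) = \<nu> * (y \<bullet> x)"
      using that(1,2) sym[of x y] by (simp add: V_def)
    then show ?thesis using that(3) by (simp add: inner_commute)
  qed
  have one: "x \<bullet> x = 1" if "x \<in> E \<mu>" for x \<mu> using E(5)[OF that] by (simp add: norm_eq_1)
  have disj: "E \<mu> \<inter> E \<nu> = {}" if "\<mu> \<noteq> \<nu>" for \<mu> \<nu>
    using orth[OF _ _ that] one E(1) by fastforce
  let ?E = "\<Union>\<mu>\<in>set_mset M. E \<mu>"
  have sums: "(\<Sum>x\<in>?E. g x) = (\<Sum>\<mu>\<in>set_mset M. \<Sum>x\<in>E \<mu>. g x)" for g :: "'a \<Rightarrow> real"
    using E(2) disj by (intro sum.UNION_disjoint) auto
  show ?thesis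
  proof (rule that)
    show "finite ?E" using E(2) by simp
    show "?E \<subseteq> T" using E(1) by (auto simp: V_def)
    have "card ?E = (\<Sum>\<mu>\<in>set_mset M. count M \<mu>)"
      using card_UN_disjoint[of "set_mset M" E] E(2,3) disj by simp
    then show "card ?E = size M" by (simp add: size_multiset_overloaded_eq)
    show "\<forall>x\<in>?E. \<forall>y\<in>?E. x \<bullet> y = (if x = y then 1 else 0)"
    proof (intro ballI)
      fix x y assume xy: "x \<in> ?E" "y \<in> ?E"
      obtain \<mu> \<nu> where *: "x \<in> E \<mu>" "y \<in> E \<nu>" using xy by auto
      show "x \<bullet> y = (if x = y then 1 else 0)"
      proof (cases "\<mu> = \<nu>")
        case True
        then show ?thesis using * one E(4)[of \<mu>] by (auto simp: pairwise_def orthogonal_def)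
      next
        case False
        then show ?thesis using * orth[OF _ _ False] E(1) disj by (metis disjoint_iff subset_iff)
      qed
    qed
    have "B x x = \<mu>" if "x \<in> E \<mu>" for x \<mu>
      using one[OF that] that E(1)[of \<mu>] by (auto simp: V_def)
    then have "(\<Sum>x\<in>?E. B x x) = (\<Sum>\<mu>\<in>set_mset M. count M \<mu> * \<mu>)"
      unfolding sums using E(3) by simp
    also have "\<dots> = sum_mset M"
      by (rule sum_mset_eq_sum_count) auto
    finally show "(\<Sum>x\<in>?E. B x x) = sum_mset M" .
  qed
qed

subsection \<open>Second derivatives\<close>

lemma partial_derivative_line:
  assumes "smooth f"
  shows "((\<lambda>t. f (x + t *\<^sub>R axis i 1)) has_real_derivative
    partial_derivative i f (x + t *\<^sub>R axis i 1)) (at t)"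
proof -
  have "((\<lambda>t. f (x + t *\<^sub>R axis i 1)) has_derivative
      (\<lambda>h. gradient f (x + t *\<^sub>R axis i 1) \<bullet> (h *\<^sub>R axis i 1))) (at t)"
    by (rule has_derivative_compose[OF _ smooth_has_derivative[OF assms]])
      (auto intro!: derivative_eq_intros)
  then show ?thesis
    by (simp add: has_field_derivative_def inner_axis gradient_def mult.commute[of _ "partial_derivative _ _ _"])
qed

text \<open>The mean value theorem is applied twice: in direction \<open>i\<close> to the increment
  of \<open>f\<close> along direction \<open>j\<close>, then in direction \<open>j\<close> to
  \<open>partial_derivative i f\<close>.\<close>

lemma second_difference:
  assumes "smooth f" "h > 0"
  shows "\<exists>s t. 0 < s \<and> s < h \<and> 0 < t \<and> t < h \<and>
    f (x + h *\<^sub>R axis i 1 + h *\<^sub>R axis j 1) - f (x + h *\<^sub>R axis i 1)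
      - f (x + h *\<^sub>R axis j 1) + f x =
    h * h * partial_derivative j (partial_derivative i f) (x + s *\<^sub>R axis i 1 + t *\<^sub>R axis j 1)"
proof -
  let ?u = "axis i 1" and ?v = "axis j 1"
  have "((\<lambda>s. f ((x + h *\<^sub>R ?v) + s *\<^sub>R ?u) - f (x + s *\<^sub>R ?u)) has_real_derivative
      partial_derivative i f ((x + h *\<^sub>R ?v) + s *\<^sub>R ?u) - partial_derivative i f (x + s *\<^sub>R ?u)) (at s)" for s
    by (intro DERIV_diff partial_derivative_line assms)
  from MVT2[OF \<open>h > 0\<close> this] obtain s where s: "0 < s" "s < h"
    "f ((x + h *\<^sub>R ?v) + h *\<^sub>R ?u) - f (x + h *\<^sub>R ?u) - (f (x + h *\<^sub>R ?v) - f x) =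
      h * (partial_derivative i f ((x + h *\<^sub>R ?v) + s *\<^sub>R ?u) - partial_derivative i f (x + s *\<^sub>R ?u))"
    by auto
  have "((\<lambda>t. partial_derivative i f ((x + s *\<^sub>R ?u) + t *\<^sub>R ?v)) has_real_derivative
      partial_derivative j (partial_derivative i f) ((x + s *\<^sub>R ?u) + t *\<^sub>R ?v)) (at t)" for t
    by (intro partial_derivative_line smooth_partial assms)
  from MVT2[OF \<open>h > 0\<close> this] obtain t where t: "0 < t" "t < h"
    "partial_derivative i f ((x + s *\<^sub>R ?u) + h *\<^sub>R ?v) - partial_derivative i f (x + s *\<^sub>R ?u) =
      h * partial_derivative j (partial_derivative i f) ((x + s *\<^sub>R ?u) + t *\<^sub>R ?v)"
    by auto
  show ?thesis
    using s t by (intro exI[of _ s] exI[of _ t]) (simp add: algebra_simps)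
qed

lemma mixed_partial_derivatives_commute:
  assumes "smooth f"
  shows "partial_derivative i (partial_derivative j f) x = partial_derivative j (partial_derivative i f) x"
proof (rule ccontr)
  let ?a = "partial_derivative j (partial_derivative i f)" and ?b = "partial_derivative i (partial_derivative j f)"
  assume neq: "\<not> ?thesis"
  \<comment> \<open>The second difference is symmetric in \<open>i\<close> and \<open>j\<close>, so
    both mixed derivatives attain a common value at points near \<open>x\<close>. With
    \<open>e\<close> half the supposed gap, two errors below \<open>e\<close> cannot bridge
    it.\<close>
  define e where "e = \<bar>?a x - ?b x\<bar> / 2"
  have "e > 0" using neq by (simp add: e_def)
  have "isCont ?a x" "isCont ?b x"
    using assms by (auto intro!: differentiable_imp_continuous_within smooth_differentiable smooth_partial)
  then obtain d1 d2 where d: "d1 > 0" "\<And>y. dist y x < d1 \<Longrightarrow> dist (?a y) (?a x) < e"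
      "d2 > 0" "\<And>y. dist y x < d2 \<Longrightarrow> dist (?b y) (?b x) < e"
    using \<open>e > 0\<close> unfolding continuous_at_eps_delta by metis
  define h where "h = min d1 d2 / 2"
  have h: "h > 0" "2 * h \<le> d1" "2 * h \<le> d2" using d by (auto simp: h_def)
  have near: "dist (x + s *\<^sub>R axis k 1 + t *\<^sub>R axis l 1) x < 2 * h"
    if "0 < s" "s < h" "0 < t" "t < h" for s t k l
  proof -
    have "norm (s *\<^sub>R axis k (1::real) + t *\<^sub>R axis l 1) \<le> s + t"
      using norm_triangle_ineq[of "s *\<^sub>R axis k (1::real)" "t *\<^sub>R axis l 1"] that by simp
    then show ?thesis using that by (simp add: dist_norm algebra_simps)
  qed
  obtain s t where st: "0 < s" "s < h" "0 < t" "t < h"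
    "f (x + h *\<^sub>R axis i 1 + h *\<^sub>R axis j 1) - f (x + h *\<^sub>R axis i 1)
      - f (x + h *\<^sub>R axis j 1) + f x = h * h * ?a (x + s *\<^sub>R axis i 1 + t *\<^sub>R axis j 1)"
    using second_difference[OF assms h(1)] by metis
  obtain s' t' where st': "0 < s'" "s' < h" "0 < t'" "t' < h"
    "f (x + h *\<^sub>R axis j 1 + h *\<^sub>R axis i 1) - f (x + h *\<^sub>R axis j 1)
      - f (x + h *\<^sub>R axis i 1) + f x = h * h * ?b (x + s' *\<^sub>R axis j 1 + t' *\<^sub>R axis i 1)"
    using second_difference[OF assms h(1)] by metis
  let ?y = "x + s *\<^sub>R axis i 1 + t *\<^sub>R axis j 1" and ?z = "x + s' *\<^sub>R axis j 1 + t' *\<^sub>R axis i 1"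
  have "h * h * ?a ?y = h * h * ?b ?z" using st(5) st'(5) by (simp add: algebra_simps)
  then have "?a ?y = ?b ?z" using h(1) by simp
  moreover have "dist (?a ?y) (?a x) < e" "dist (?b ?z) (?b x) < e"
    using near[OF st(1-4), of i j] near[OF st'(1-4), of j i] h by (auto intro!: d)
  ultimately have "dist (?a x) (?b x) < e + e"
    using dist_triangle2[of "?a x" "?b x" "?a ?y"] by (simp add: dist_commute)
  then show False by (simp add: e_def dist_real_def)
qed

text \<open>Differentiating component \<open>i\<close> of the gradient yields the transposed order
  of the two partial derivatives in \<open>hessian\<close>, so their symmetry enters here.\<close>

lemma gradient_has_derivative:
  assumes "smooth f"
  shows "(gradient f has_derivative (\<lambda>h. hessian f x *v h)) (at x)"
proof (subst has_derivative_componentwise_within, rule ballI)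
  fix b :: "real^'a" assume "b \<in> Basis"
  then obtain i where b: "b = axis i 1" by (auto simp: Basis_vec_def)
  have "((\<lambda>x. partial_derivative i f x) has_derivative (\<lambda>h. gradient (partial_derivative i f) x \<bullet> h)) (at x)"
    by (intro smooth_has_derivative smooth_partial assms)
  moreover have "gradient (partial_derivative i f) x \<bullet> h = (hessian f x *v h) \<bullet> b" for h
  proof -
    have "(hessian f x *v h) \<bullet> b = (hessian f x *v h) $ i" by (simp add: b inner_axis)
    then show ?thesis
      by (simp add: inner_vec_def matrix_vector_mult_def gradient_def hessian_def
          mixed_partial_derivatives_commute[OF assms, of i])
  qed
  ultimately show "((\<lambda>x. gradient f x \<bullet> b) has_derivative (\<lambda>h. (hessian f x *v h) \<bullet> b)) (at x)"
    by (simp add: b inner_axis gradient_def)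
qed

lemma second_fundamental_form_sym:
  assumes "smooth \<rho>"
  shows "second_fundamental_form \<rho> p \<xi> \<eta> = second_fundamental_form \<rho> p \<eta> \<xi>"
proof -
  have "transpose (hessian \<rho> p) = hessian \<rho> p"
    by (simp add: transpose_def hessian_def vec_eq_iff mixed_partial_derivatives_commute[OF assms])
  then show ?thesis
    unfolding second_fundamental_form_def
    by (metis dot_lmul_matrix inner_commute transpose_matrix_vector)
qed

lemma bounded_bilinear_second_fundamental_form:
  "bounded_bilinear (second_fundamental_form \<rho> p)"
  unfolding bilinear_conv_bounded_bilinear[symmetric] bilinear_def second_fundamental_form_def
  by (auto intro!: linearI simp: inner_add_left inner_add_right matrix_vector_right_distrib
      matrix_vector_mult_scaleR)

lemma subspace_tangent_space: "subspace (tangent_space \<rho> p)"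
  by (auto simp: tangent_space_def subspace_def inner_add_right)

section \<open>Second-order comparison of touching sublevel sets\<close>

lemma second_derivative_pos_imp_increase:
  fixes g :: "real \<Rightarrow> real"
  assumes "\<And>t. (g has_real_derivative g' t) (at t)" and "g' 0 = 0"
    and "(g' has_real_derivative c) (at 0)" and "c > 0"
  shows "\<forall>\<^sub>F t in at_right 0. g 0 < g t"
proof -
  obtain d where d: "d > 0" "\<And>h. 0 < h \<Longrightarrow> h < d \<Longrightarrow> g' 0 < g' (0 + h)"
    using DERIV_pos_inc_right[OF assms(3,4)] by auto
  have "g 0 < g t" if t: "0 < t" "t < d" for t
  proof -
    obtain z where "0 < z" "z < t" "g t - g 0 = (t - 0) * g' z"
      using MVT2[OF t(1) assms(1)] by blast
    moreover have "g' z > 0" using d(2)[of z] assms(2) t calculation by simp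
    ultimately show ?thesis using t by (simp add: algebra_simps)
  qed
  then show ?thesis using d(1) by (auto simp: eventually_at_right_field)
qed

text \<open>Along the parabola \<open>f\<close> has first derivative
  \<open>G x \<bullet> \<xi> = 0\<close> at 0, and its second derivative is the Hessian term plus
  \<open>s * (G x \<bullet> N)\<close> from the acceleration \<open>s *\<^sub>R N\<close>.\<close>

lemma parabola_increase:
  fixes f :: "'a::euclidean_space \<Rightarrow> real"
  assumes f: "\<And>y. (f has_derivative (\<lambda>h. G y \<bullet> h)) (at y)"
    and G: "(G has_derivative A) (at x)"
    and "G x \<bullet> \<xi> = 0" and "A \<xi> \<bullet> \<xi> + s * (G x \<bullet> N) > 0"
  shows "\<forall>\<^sub>F t in at_right 0. f x < f (x + t *\<^sub>R \<xi> + (s * t\<^sup>2 / 2) *\<^sub>R N)"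
proof -
  define c where "c t = x + t *\<^sub>R \<xi> + (s * t\<^sup>2 / 2) *\<^sub>R N" for t :: real
  have c: "(c has_derivative (\<lambda>h. h *\<^sub>R (\<xi> + (s * t) *\<^sub>R N))) (at t)" for t
    unfolding c_def by (auto intro!: derivative_eq_intros simp: algebra_simps)
  have c0: "c 0 = x" by (simp add: c_def)
  have 1: "((\<lambda>t. f (c t)) has_real_derivative G (c t) \<bullet> (\<xi> + (s * t) *\<^sub>R N)) (at t)" for t
    using has_derivative_compose[OF c f] by (simp add: has_field_derivative_def mult_commute_abs)
  have A: "A (h *\<^sub>R \<xi>) = h *\<^sub>R A \<xi>" for h
    using has_derivative_linear[OF G] by (rule linear_scale)
  have "((\<lambda>t. G (c t)) has_derivative (\<lambda>h. h *\<^sub>R A \<xi>)) (at 0)"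
    using has_derivative_compose[OF c[of 0], of G A] G by (simp add: c0 A)
  then have "((\<lambda>t. G (c t) \<bullet> (\<xi> + (s * t) *\<^sub>R N)) has_derivative
      (\<lambda>h. G (c 0) \<bullet> (s * h) *\<^sub>R N + (h *\<^sub>R A \<xi>) \<bullet> (\<xi> + (s * 0) *\<^sub>R N))) (at 0)"
    by (intro has_derivative_inner) (auto intro!: derivative_eq_intros)
  then have "((\<lambda>t. G (c t) \<bullet> (\<xi> + (s * t) *\<^sub>R N)) has_derivative
      (\<lambda>h. (A \<xi> \<bullet> \<xi> + s * (G x \<bullet> N)) * h)) (at 0)"
    by (simp add: c0 algebra_simps)
  then have 2: "((\<lambda>t. G (c t) \<bullet> (\<xi> + (s * t) *\<^sub>R N)) has_real_derivative
      A \<xi> \<bullet> \<xi> + s * (G x \<bullet> N)) (at 0)"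
    by (simp add: has_field_derivative_def)
  have "\<forall>\<^sub>F t in at_right 0. f (c 0) < f (c t)"
    by (rule second_derivative_pos_imp_increase[OF 1 _ 2]) (use assms(3,4) in \<open>auto simp: c0\<close>)
  then show ?thesis by (simp only: c0) (simp only: c_def)
qed

lemma line_increase:
  fixes f :: "'a::euclidean_space \<Rightarrow> real"
  assumes "(f has_derivative (\<lambda>h. g \<bullet> h)) (at x)" and "g \<bullet> v > 0"
  shows "\<forall>\<^sub>F t in at_right 0. f x < f (x + t *\<^sub>R v)"
proof -
  have "((\<lambda>t. f (x + t *\<^sub>R v)) has_derivative (\<lambda>h. g \<bullet> (h *\<^sub>R v))) (at 0)"
    by (rule has_derivative_compose[where g=f]) (use assms(1) in \<open>auto intro!: derivative_eq_intros\<close>)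
  then have "((\<lambda>t. f (x + t *\<^sub>R v)) has_real_derivative g \<bullet> v) (at 0)"
    by (simp add: has_field_derivative_def mult_commute_abs)
  from DERIV_pos_inc_right[OF this assms(2)] show ?thesis
    by (auto simp: eventually_at_right_field)
qed

text \<open>No curve starting at \<open>x\<close> can strictly decrease \<open>\<phi>\<close> and
  strictly increase \<open>f\<close>. Straight lines then force the gradients to be positively
  proportional, and parabolas tangent to the level set compare the Hessians. The factor
  \<open>l\<close> rescales \<open>\<phi>\<close> to the same gradient.\<close>

lemma touching_sublevel_sets:
  fixes f \<phi> :: "'a::euclidean_space \<Rightarrow> real"
  assumes f: "\<And>y. (f has_derivative (\<lambda>h. G y \<bullet> h)) (at y)" "(G has_derivative A) (at x)"
    and \<phi>: "\<And>y. (\<phi> has_derivative (\<lambda>h. K y \<bullet> h)) (at y)" "(K has_derivative L) (at x)"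
    and "G x \<noteq> 0" "K x \<noteq> 0"
    and le: "\<forall>\<^sub>F y in nhds x. \<phi> y < \<phi> x \<longrightarrow> f y < f x"
  obtains l where "l > 0" "G x = l *\<^sub>R K x"
    "\<And>\<xi>. K x \<bullet> \<xi> = 0 \<Longrightarrow> A \<xi> \<bullet> \<xi> \<le> l * (L \<xi> \<bullet> \<xi>)"
proof -
  have f': "((\<lambda>y. - f y) has_derivative (\<lambda>h. (- G y) \<bullet> h)) (at y)" for y
    using has_derivative_minus[OF f(1)] by simp
  have \<phi>': "((\<lambda>y. - \<phi> y) has_derivative (\<lambda>h. (- K y) \<bullet> h)) (at y)" for y
    using has_derivative_minus[OF \<phi>(1)] by simp
  have curve: False
    if c: "isCont c 0" "c 0 = x" and "\<forall>\<^sub>F t in at_right 0. - \<phi> x < - \<phi> (c t)"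
      "\<forall>\<^sub>F t in at_right 0. f x < f (c t)" for c :: "real \<Rightarrow> 'a"
  proof -
    have "filterlim c (nhds x) (at_right 0)"
      using c filterlim_mono[OF _ order_refl at_le] unfolding isCont_def
      by (metis UNIV_I subsetI)
    with le have "\<forall>\<^sub>F t in at_right 0. \<phi> (c t) < \<phi> x \<longrightarrow> f (c t) < f x"
      by (rule eventually_compose_filterlim)
    with that(3,4) have "\<forall>\<^sub>F t in at_right (0::real). False"
      by eventually_elim auto
    then show False by (simp add: trivial_limit_at_right_real)
  qed
  have half: "G x \<bullet> v \<le> 0" if "K x \<bullet> v < 0" for v
  proof (rule ccontr)
    assume "\<not> G x \<bullet> v \<le> 0"
    then show False
      using line_increase[OF f(1), of x v] line_increase[OF \<phi>', of x v] that
      by (intro curve[of "\<lambda>t. x + t *\<^sub>R v"]) auto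
  qed
  define n where "n = K x \<bullet> K x"
  have n: "n > 0" using \<open>K x \<noteq> 0\<close> by (simp add: n_def)
  define l where "l = (G x \<bullet> K x) / n"
  have "l \<ge> 0" using half[of "- K x"] n by (simp add: l_def n_def)
  have Geq: "G x = l *\<^sub>R K x"
  proof (rule ccontr)
    define w where "w = G x - l *\<^sub>R K x"
    assume "G x \<noteq> l *\<^sub>R K x"
    then have w: "w \<bullet> w > 0" by (simp add: w_def)
    have Kw: "K x \<bullet> w = 0" using n by (simp add: w_def l_def inner_diff_right inner_commute n_def)
    have "G x = w + l *\<^sub>R K x" by (simp add: w_def)
    then have Gw: "G x \<bullet> w = w \<bullet> w" using Kw by (simp add: inner_add_left)
    \<comment> \<open>The component \<open>w\<close> of \<open>G x\<close> orthogonal to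
      \<open>K x\<close> increases \<open>f\<close> but leaves \<open>\<phi>\<close> stationary to
      first order. Subtracting \<open>d *\<^sub>R K x\<close> decreases \<open>\<phi>\<close>, with
      \<open>d\<close> so small that at least half of the increase of \<open>f\<close>
      remains.\<close>
    define d where "d = (w \<bullet> w) / (2 * (\<bar>G x \<bullet> K x\<bar> + 1))"
    have "d > 0" using w by (simp add: d_def add_nonneg_pos)
    have "d * (G x \<bullet> K x) \<le> d * (\<bar>G x \<bullet> K x\<bar> + 1)" using \<open>d > 0\<close> by (intro mult_left_mono) auto
    also have "\<dots> = (w \<bullet> w) / 2" by (simp add: d_def divide_simps)
    also have "\<dots> < w \<bullet> w" using w by simp
    finally have "G x \<bullet> (w - d *\<^sub>R K x) > 0" by (simp add: inner_diff_right Gw)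
    moreover have "K x \<bullet> (w - d *\<^sub>R K x) < 0"
      using \<open>d > 0\<close> n by (simp add: inner_diff_right Kw n_def)
    ultimately show False using half by fastforce
  qed
  with \<open>l \<ge> 0\<close> \<open>G x \<noteq> 0\<close> have "l > 0" by (cases "l = 0") auto
  moreover have "A \<xi> \<bullet> \<xi> \<le> l * (L \<xi> \<bullet> \<xi>)" if \<xi>: "K x \<bullet> \<xi> = 0" for \<xi>
  proof (rule ccontr)
    assume *: "\<not> ?thesis"
    \<comment> \<open>To decrease \<open>\<phi>\<close> the acceleration must lie below
      \<open>- (L \<xi> \<bullet> \<xi>) / n\<close>, and to increase \<open>f\<close> above
      \<open>- (A \<xi> \<bullet> \<xi>) / (l * n)\<close>. The negated claim makes this interval
      nonempty, and \<open>s\<close> is its midpoint.\<close>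
    define s where "s = - (L \<xi> \<bullet> \<xi> + (A \<xi> \<bullet> \<xi>) / l) / (2 * n)"
    have "((\<lambda>y. - K y) has_derivative (\<lambda>h. - L h)) (at x)"
      using \<phi>(2) by (rule has_derivative_minus)
    moreover have "(- L \<xi>) \<bullet> \<xi> + s * ((- K x) \<bullet> K x) > 0"
    proof -
      have "(- L \<xi>) \<bullet> \<xi> + s * ((- K x) \<bullet> K x) = ((A \<xi> \<bullet> \<xi>) / l - L \<xi> \<bullet> \<xi>) / 2"
        using n by (simp add: s_def flip: n_def) (simp add: field_simps)
      also have "\<dots> > 0" using * \<open>l > 0\<close> by (simp add: field_simps)
      finally show ?thesis .
    qed
    ultimately have 1: "\<forall>\<^sub>F t in at_right 0. - \<phi> x < - \<phi> (x + t *\<^sub>R \<xi> + (s * t\<^sup>2 / 2) *\<^sub>R K x)"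
      using \<xi> by (intro parabola_increase[OF \<phi>']) auto
    have "A \<xi> \<bullet> \<xi> + s * (G x \<bullet> K x) > 0"
    proof -
      have "A \<xi> \<bullet> \<xi> + s * (G x \<bullet> K x) = (A \<xi> \<bullet> \<xi> - l * (L \<xi> \<bullet> \<xi>)) / 2"
        using n \<open>l > 0\<close> by (simp add: s_def Geq flip: n_def) (simp add: field_simps)
      also have "\<dots> > 0" using * by simp
      finally show ?thesis .
    qed
    then have 2: "\<forall>\<^sub>F t in at_right 0. f x < f (x + t *\<^sub>R \<xi> + (s * t\<^sup>2 / 2) *\<^sub>R K x)"
      using \<xi> by (intro parabola_increase[OF f]) (auto simp: Geq)
    show False
      by (rule curve[OF _ _ 1 2]) (auto intro!: continuous_intros)
  qed
  ultimately show ?thesis using that Geq by blast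
qed

text \<open>For unit vectors \<open>a\<close> and \<open>b\<close> this agrees on the orthogonal complement of \<open>a\<close> with the
  reflection along \<open>a + b\<close>, which maps \<open>a\<close> to \<open>- b\<close>.\<close>

definition tilt :: "'a::real_inner \<Rightarrow> 'a \<Rightarrow> 'a \<Rightarrow> 'a"
  where "tilt a b v = v - ((b \<bullet> v) / (1 + a \<bullet> b)) *\<^sub>R (a + b)"

text \<open>The denominator \<open>1 + a \<bullet> b\<close> is half the squared length of
  \<open>a + b\<close>, as in a reflection. The map carries an orthonormal family normal to
  \<open>a\<close> to one normal to \<open>b\<close>, depending continuously on \<open>b\<close>
  away from \<open>- a\<close>.\<close>

lemma tilt_isometric:
  assumes "norm a = 1" "norm b = 1" "a \<bullet> b \<noteq> - 1" "a \<bullet> v = 0" "a \<bullet> w = 0"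
  shows "tilt a b v \<bullet> tilt a b w = v \<bullet> w"
proof -
  define d where "d = 1 + a \<bullet> b"
  have d: "d \<noteq> 0" using assms(3) by (simp add: d_def add_eq_0_iff)
  have "a \<bullet> a = 1" "b \<bullet> b = 1" using assms(1,2) by (simp_all add: norm_eq_1)
  then have "(a + b) \<bullet> (a + b) = 2 * d"
    by (simp add: d_def inner_add_left inner_add_right inner_commute)
  then have "tilt a b v \<bullet> tilt a b w = v \<bullet> w - (b \<bullet> w) / d * (b \<bullet> v) - (b \<bullet> v) / d * (b \<bullet> w)
      + (b \<bullet> v) / d * ((b \<bullet> w) / d) * (2 * d)"
    using assms(4,5) unfolding tilt_def d_def[symmetric]
    by (simp add: inner_diff_left inner_diff_right)
      (simp add: inner_add_left inner_add_right inner_commute algebra_simps)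
  also have "\<dots> = v \<bullet> w" using d by (simp add: field_simps)
  finally show ?thesis .
qed

lemma tilt_orthogonal:
  assumes "norm b = 1" "a \<bullet> b \<noteq> - 1"
  shows "b \<bullet> tilt a b v = 0"
proof -
  have "1 + a \<bullet> b \<noteq> 0" using assms(2) by (simp add: add_eq_0_iff)
  moreover have "b \<bullet> b = 1" using assms(1) by (simp add: norm_eq_1)
  ultimately show ?thesis
    by (simp add: tilt_def inner_diff_right inner_add_right inner_commute[of b a] add.commute)
qed

subsection \<open>The touching argument\<close>

text \<open>The point \<open>x\<close> minimizes \<open>\<phi>\<close> over the closed ball minus
  \<open>A j\<close>. As \<open>p\<close> competes, the minimum is at most 0, and \<open>A j\<close>
  already contains the part of the sphere where \<open>\<phi> \<le> 0\<close>; so \<open>x\<close>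
  lies in the open ball.\<close>

lemma touching_point_exists:
  fixes \<phi> :: "'a::euclidean_space \<Rightarrow> real" and A :: "nat \<Rightarrow> 'a set"
  assumes "continuous_on UNIV \<phi>" and "p \<notin> D" "\<phi> p \<le> 0"
    and inside: "\<And>y. \<phi> y \<le> 0 \<Longrightarrow> y \<noteq> p \<Longrightarrow> y \<in> D"
    and A: "\<And>j. j \<ge> 1 \<Longrightarrow> open (A j)" "\<And>j. j \<ge> 1 \<Longrightarrow> A j \<subseteq> A (j + 1)" "(\<Union>j\<in>{1..}. A j) = D"
    and "r > 0"
  obtains j x where "j \<ge> 1" "x \<in> ball p r" "x \<notin> A j"
    "\<And>y. y \<in> ball p r \<Longrightarrow> \<phi> y < \<phi> x \<Longrightarrow> y \<in> A j"
proof -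
  have mono: "A i \<subseteq> A j" if "1 \<le> i" "i \<le> j" for i j
    using that(2,1)
  proof (induction rule: dec_induct)
    case (step n)
    then show ?case using A(2)[of n] by auto
  qed simp
  let ?C = "sphere p r \<inter> {y. \<phi> y \<le> 0}"
  have comp: "compact ?C"
    using assms(1) by (intro compact_Int_closed closed_Collect_le) auto
  have cover: "?C \<subseteq> (\<Union>j\<in>{1..}. A j)"
    using inside \<open>r > 0\<close> unfolding A(3) by auto
  obtain J where J: "J \<subseteq> {1..}" "finite J" "?C \<subseteq> (\<Union>j\<in>J. A j)"
    using compactE_image[OF comp _ cover] A(1) by auto
  define j where "j = Max (insert 1 J)"
  have j: "j \<ge> 1" "\<And>i. i \<in> J \<Longrightarrow> i \<le> j" using J(2) by (auto simp: j_def)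
  have C: "?C \<subseteq> A j"
  proof
    fix y assume "y \<in> ?C"
    then obtain i where "i \<in> J" "y \<in> A i" using J(3) by blast
    then show "y \<in> A j" using mono[of i j] j(2)[of i] J(1) by auto
  qed
  have p: "p \<in> cball p r - A j" using \<open>r > 0\<close> \<open>p \<notin> D\<close> A(3) j(1) by auto
  have "compact (cball p r - A j)" using A(1) j(1) by (intro compact_diff) auto
  then obtain x where x: "x \<in> cball p r - A j" "\<And>y. y \<in> cball p r - A j \<Longrightarrow> \<phi> x \<le> \<phi> y"
    using continuous_attains_inf[of "cball p r - A j" \<phi>] p assms(1)
    by (metis continuous_on_subset emptyE subset_UNIV)
  have "\<phi> x \<le> 0" using x(2)[OF p] \<open>\<phi> p \<le> 0\<close> by simp
  with C x(1) have "dist p x \<noteq> r" by auto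
  with x(1) have "x \<in> ball p r" by auto
  then show ?thesis
  proof (rule that[OF j(1)])
    show "x \<notin> A j" using x(1) by blast
    show "y \<in> A j" if "y \<in> ball p r" "\<phi> y < \<phi> x" for y
      using that x(2)[of y] by (cases "y \<in> A j") auto
  qed
qed

lemma isCont_mult_vec:
  fixes M :: "'b::t2_space \<Rightarrow> real^'n^'m"
  assumes "\<And>i j. isCont (\<lambda>y. M y $ i $ j) x" and "isCont v x"
  shows "isCont (\<lambda>y. M y *v v y) x"
  unfolding matrix_vector_mult_def isCont_def
  by (intro tendsto_vec_lambda tendsto_sum tendsto_mult tendsto_vec_nth assms[unfolded isCont_def])

lemma trace_nonneg_of_exhaustion:
  fixes D :: "(real^'n::finite) set" and Dj :: "nat \<Rightarrow> (real^'n) set"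
  assumes "normalized_defining_function \<rho> D"
    and Dj: "\<And>j. j \<ge> 1 \<Longrightarrow> open (Dj j)" "\<And>j. j \<ge> 1 \<Longrightarrow> Dj j \<subseteq> Dj (j + 1)"
      "(\<Union>j\<in>{1..}. Dj j) = D" "\<And>j. j \<ge> 1 \<Longrightarrow> q_convex q (Dj j)"
    and p: "p \<in> frontier D"
    and E: "finite E" "card E = q" "E \<subseteq> tangent_space \<rho> p"
      "\<And>x y. x \<in> E \<Longrightarrow> y \<in> E \<Longrightarrow> x \<bullet> y = (if x = y then 1 else 0)"
  shows "(\<Sum>e\<in>E. second_fundamental_form \<rho> p e e) \<ge> 0"
proof (rule ccontr)
  define S where "S = (\<Sum>e\<in>E. second_fundamental_form \<rho> p e e)"
  assume "\<not> (\<Sum>e\<in>E. second_fundamental_form \<rho> p e e) \<ge> 0"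
  then have "S < 0" by (simp add: S_def)
  then have "E \<noteq> {}" by (auto simp: S_def)
  then have "q > 0" using E(1,2) by auto
  have def: "defining_function \<rho> D" and grad_p: "norm (gradient \<rho> p) = 1"
    using assms(1) p by (auto simp: normalized_defining_function_def)
  then have sm: "smooth \<rho>" and D: "D = {x. \<rho> x < 0}" by (auto simp: defining_function_def)
  note p0 = defining_function_frontier[OF def p]
  \<comment> \<open>The quadratic term adds \<open>2 * \<epsilon>\<close> for each of the
    \<open>q\<close> vectors, in total \<open>- S / 2\<close>, so the perturbed trace is still
    negative.\<close>
  define \<epsilon> where "\<epsilon> = - S / (4 * q)"
  have \<epsilon>: "\<epsilon> > 0" "S + 2 * \<epsilon> * q < 0"
    using \<open>S < 0\<close> \<open>q > 0\<close> by (auto simp: \<epsilon>_def field_simps)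
  define \<phi> where "\<phi> y = \<rho> y + \<epsilon> * ((y - p) \<bullet> (y - p))" for y
  define K where "K y = gradient \<rho> y + (2 * \<epsilon>) *\<^sub>R (y - p)" for y
  define L where "L y h = hessian \<rho> y *v h + (2 * \<epsilon>) *\<^sub>R h" for y h
  have \<phi>: "(\<phi> has_derivative (\<lambda>h. K y \<bullet> h)) (at y)" for y
    unfolding \<phi>_def K_def
    by (auto intro!: derivative_eq_intros smooth_has_derivative[OF sm]
        simp: inner_add_left inner_commute algebra_simps)
  have K: "(K has_derivative L y) (at y)" for y
    unfolding K_def L_def
    by (auto intro!: derivative_eq_intros gradient_has_derivative[OF sm] simp: algebra_simps)
  define a where "a = gradient \<rho> p"
  define b where "b y = K y /\<^sub>R norm (K y)" for y
  have Kp: "K p = a" by (simp add: K_def a_def)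
  have a: "norm a = 1" "a \<bullet> a = 1" using grad_p by (simp_all add: a_def norm_eq_1)
  have bp: "b p = a" by (simp add: b_def Kp a)
  \<comment> \<open>The trace of the Hessian of \<open>\<phi>\<close> at \<open>y\<close> over the
    family \<open>E\<close> turned from the normal \<open>a\<close> at \<open>p\<close> to the unit
    normal \<open>b y\<close> of the level set through \<open>y\<close>. At \<open>p\<close> nothing
    is turned, and continuity keeps the trace negative nearby.\<close>
  define \<Psi> where "\<Psi> y = (\<Sum>e\<in>E. L y (tilt a (b y) e) \<bullet> tilt a (b y) e)" for y
  have contK: "isCont K p" using K by (rule has_derivative_continuous)
  have contb: "isCont b p"
    unfolding b_def using contK Kp a(1) by (intro continuous_intros) auto
  have "isCont \<Psi> p"
  proof -
    have "isCont (\<lambda>y. tilt a (b y) e) p" for e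
      unfolding tilt_def using contb bp a(2) by (intro continuous_intros) auto
    moreover have "isCont (\<lambda>y. hessian \<rho> y $ i $ j) p" for i j
      unfolding hessian_def
      by (simp add: differentiable_imp_continuous_within smooth_differentiable smooth_partial sm)
    ultimately show ?thesis
      unfolding \<Psi>_def L_def
      by (intro continuous_sum continuous_inner continuous_add continuous_scaleR
          continuous_const isCont_mult_vec)
  qed
  moreover have "\<Psi> p < 0"
  proof -
    have "tilt a a e = e" if "e \<in> E" for e
      using that E(3) by (auto simp: tilt_def a_def tangent_space_def)
    then have "\<Psi> p = (\<Sum>e\<in>E. second_fundamental_form \<rho> p e e + 2 * \<epsilon>)"
      unfolding \<Psi>_def bp L_def second_fundamental_form_def using E(4)
      by (intro sum.cong) (auto simp: inner_add_right inner_commute)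
    then show ?thesis using \<epsilon>(2) E(2) by (simp add: sum.distrib S_def mult_ac)
  qed
  ultimately have "\<forall>\<^sub>F y in nhds p. \<Psi> y < 0"
    by (metis continuous_within isCont_def order_tendstoD(2) tendsto_at_iff_tendsto_nhds)
  moreover have "\<forall>\<^sub>F y in nhds p. K y \<noteq> 0"
    using contK Kp a(1) tendsto_imp_eventually_ne[of K a "nhds p" 0]
    by (force simp: isCont_def tendsto_at_iff_tendsto_nhds)
  moreover have "\<forall>\<^sub>F y in nhds p. a \<bullet> b y > - 1"
  proof -
    have "isCont (\<lambda>y. a \<bullet> b y) p" using contb by (intro continuous_intros)
    then have "((\<lambda>y. a \<bullet> b y) \<longlongrightarrow> a \<bullet> b p) (nhds p)"
      using tendsto_at_iff_tendsto_nhds[of "\<lambda>y. a \<bullet> b y" p] by (simp add: isCont_def)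
    then show ?thesis
      by (rule order_tendstoD(1)) (simp add: a(2) bp)
  qed
  ultimately have "\<forall>\<^sub>F y in nhds p. \<Psi> y < 0 \<and> K y \<noteq> 0 \<and> a \<bullet> b y > - 1"
    by eventually_elim auto
  then obtain r where r: "r > 0" "\<And>y. y \<in> ball p r \<Longrightarrow> \<Psi> y < 0 \<and> K y \<noteq> 0 \<and> a \<bullet> b y > - 1"
    unfolding eventually_nhds_metric by (auto simp: dist_commute)
  have inside: "y \<in> D" if "\<phi> y \<le> 0" "y \<noteq> p" for y
  proof -
    have "\<epsilon> * ((y - p) \<bullet> (y - p)) > 0" using \<epsilon>(1) that(2) by simp
    then show ?thesis using that(1) by (simp add: \<phi>_def D)
  qed
  have "continuous_on UNIV \<phi>"
    using \<phi> by (intro continuous_at_imp_continuous_on ballI has_derivative_continuous)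
  moreover have "\<phi> p \<le> 0" by (simp add: \<phi>_def p0)
  ultimately obtain j x where x: "j \<ge> 1" "x \<in> ball p r" "x \<notin> Dj j"
      "\<And>y. y \<in> ball p r \<Longrightarrow> \<phi> y < \<phi> x \<Longrightarrow> y \<in> Dj j"
    using touching_point_exists[of \<phi> p D Dj r] p0(2) inside Dj(1-3) r(1) by metis
  have Kx: "K x \<noteq> 0" "a \<bullet> b x \<noteq> - 1" "\<Psi> x < 0" using r(2)[OF x(2)] by auto
  have xfr: "x \<in> frontier (Dj j)"
  proof -
    have "x \<in> closure (Dj j)"
    proof (rule ccontr)
      assume "x \<notin> closure (Dj j)"
      \<comment> \<open>Away from the closure of \<open>Dj j\<close>, the point \<open>x\<close>
        would be a local minimum of \<open>\<phi>\<close>, but the gradient \<open>K x\<close> is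
        nonzero.\<close>
      then have "\<phi> x \<le> \<phi> y" if "y \<in> ball p r \<inter> - closure (Dj j)" for y
        using that x(4)[of y] closure_subset[of "Dj j"] by force
      then have "(\<lambda>h. K x \<bullet> h) = (\<lambda>h. 0)"
        using differential_zero_maxmin[of x "ball p r \<inter> - closure (Dj j)" \<phi>, OF _ _ \<phi>]
          x(2) \<open>x \<notin> closure (Dj j)\<close> by (auto intro: open_Int)
      then have "K x \<bullet> K x = 0" by metis
      then show False using Kx(1) by simp
    qed
    then show ?thesis using x(3) Dj(1)[OF x(1)] by (simp add: frontier_def interior_open)
  qed
  obtain \<sigma> where ndef: "normalized_defining_function \<sigma> (Dj j)"
    and M: "\<And>M. size M = q \<Longrightarrow> (\<And>\<mu>. count M \<mu> \<le> dim (sff_eigenspace \<sigma> x \<mu>)) \<Longrightarrow> sum_mset M \<ge> 0"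
    using Dj(4)[OF x(1)] xfr unfolding q_convex_def by metis
  have "defining_function \<sigma> (Dj j)" using ndef by (simp add: normalized_defining_function_def)
  then have \<sigma>: "smooth \<sigma>" "Dj j = {y. \<sigma> y < 0}" "gradient \<sigma> x \<noteq> 0" "\<sigma> x = 0"
    using xfr defining_function_frontier(1)[OF _ xfr] unfolding defining_function_def by blast+
  have "\<forall>\<^sub>F y in nhds x. \<phi> y < \<phi> x \<longrightarrow> \<sigma> y < \<sigma> x"
    using x(2,4) \<sigma>(2,4) unfolding eventually_nhds by (intro exI[of _ "ball p r"]) auto
  from touching_sublevel_sets[OF smooth_has_derivative[OF \<sigma>(1)] gradient_has_derivative[OF \<sigma>(1)]
      \<phi> K \<sigma>(3) Kx(1) this]
  obtain l where l: "l > 0" "gradient \<sigma> x = l *\<^sub>R K x"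
    "\<And>\<xi>. K x \<bullet> \<xi> = 0 \<Longrightarrow> (hessian \<sigma> x *v \<xi>) \<bullet> \<xi> \<le> l * (L x \<xi> \<bullet> \<xi>)" by blast
  have bx: "norm (b x) = 1" using Kx(1) by (simp add: b_def)
  have tan: "K x \<bullet> tilt a (b x) e = 0" for e
  proof -
    have "K x = norm (K x) *\<^sub>R b x" using Kx(1) by (simp add: b_def)
    then show ?thesis using tilt_orthogonal[OF bx Kx(2)] by (metis inner_scaleR_left mult_zero_right)
  qed
  \<comment> \<open>The gradients of \<open>\<sigma>\<close> and \<open>\<phi>\<close> at
    \<open>x\<close> are parallel, so the turned family is orthonormal in the tangent space of
    \<open>\<sigma>\<close>. There \<open>q\<close>-convexity makes the trace nonnegative, while the
    touching comparison bounds it by \<open>l * \<Psi> x < 0\<close>.\<close>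
  have "0 \<le> (\<Sum>e\<in>E. second_fundamental_form \<sigma> x (tilt a (b x) e) (tilt a (b x) e))"
  proof (rule trace_nonneg_if_eigenvalue_sums_nonneg[OF subspace_tangent_space
        bounded_bilinear_second_fundamental_form second_fundamental_form_sym[OF \<sigma>(1)] _ E(1,2)])
    show "tilt a (b x) e \<in> tangent_space \<sigma> x" if "e \<in> E" for e
      using tan by (simp add: tangent_space_def l(2))
    show "tilt a (b x) e \<bullet> tilt a (b x) e' = (if e = e' then 1 else 0)" if "e \<in> E" "e' \<in> E" for e e'
    proof -
      have "a \<bullet> e = 0" "a \<bullet> e' = 0" using that E(3) by (auto simp: a_def tangent_space_def)
      then show ?thesis using tilt_isometric[OF a(1) bx Kx(2)] E(4)[OF that] by simp
    qed
  qed (use M in \<open>auto simp: sff_eigenspace_def\<close>)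
  also have "\<dots> \<le> (\<Sum>e\<in>E. l * (L x (tilt a (b x) e) \<bullet> tilt a (b x) e))"
    using l(3)[OF tan] by (intro sum_mono) (simp add: second_fundamental_form_def inner_commute)
  also have "\<dots> = l * \<Psi> x" by (simp add: \<Psi>_def sum_distrib_left)
  also have "\<dots> < 0" using l(1) Kx(3) by (simp add: mult_less_0_iff)
  finally show False by simp
qed

theorem theorem1p4:
  fixes q :: nat
    and D :: "(real^'n::finite) set"
    and Dj :: "nat \<Rightarrow> (real^'n) set"
  assumes "CARD('n) \<ge> 2"
    and "1 \<le> q" and "q \<le> CARD('n) - 1"
    and "D \<noteq> {}" and "open D" and "connected D" and "bounded D"
    and "has_smooth_boundary D"
    and "\<And>j. j \<ge> 1 \<Longrightarrow> open (Dj j) \<and> Dj j \<subseteq> D"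
    and "\<And>j. j \<ge> 1 \<Longrightarrow> Dj j \<subseteq> Dj (j + 1)"
    and "(\<Union>j\<in>{1..}. Dj j) = D"
    and "\<And>j. j \<ge> 1 \<Longrightarrow> q_convex q (Dj j)"
  shows "q_convex q D"
proof -
  obtain \<rho> where \<rho>: "normalized_defining_function \<rho> D"
    using normalized_defining_function_exists assms(7,8) by blast
  then have sm: "smooth \<rho>"
    by (simp add: normalized_defining_function_def defining_function_def)
  have "sum_mset M \<ge> 0" if p: "p \<in> frontier D" and M: "size M = q"
    "\<And>\<mu>. count M \<mu> \<le> dim (sff_eigenspace \<rho> p \<mu>)" for p and M :: "real multiset"
  proof -
    \<comment> \<open>The sum over \<open>M\<close> is rewritten as a trace over orthonormal tangent
      vectors: unlike individual eigenvalues, such a trace can be moved to a nearby point by turning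
      the vectors.\<close>
    from orthonormal_eigenvectors_exist[OF subspace_tangent_space
          bounded_bilinear_second_fundamental_form second_fundamental_form_sym[OF sm]
          M(2)[unfolded sff_eigenspace_def]]
    obtain E where "finite E" "card E = size M" "E \<subseteq> tangent_space \<rho> p"
      "\<forall>x\<in>E. \<forall>y\<in>E. x \<bullet> y = (if x = y then 1 else 0)"
      "(\<Sum>x\<in>E. second_fundamental_form \<rho> p x x) = sum_mset M" .
    then show ?thesis
      using trace_nonneg_of_exhaustion[OF \<rho> _ assms(10-12) p, of E] assms(9) M(1) by auto
  qed
  then show ?thesis
    unfolding q_convex_def using assms(5,7) \<rho> by blast
qed

end
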